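(* Let $\alpha\in\mathbb{R}^{d_1}_{++}$ with $\sum_{i\in[d_1]}\alpha_i=1$, let $f^*(u,w)=-\ln\big(\prod_{i\in[d_1]}(u_i/\alpha_i)^{2\alpha_i}-\|w\|^2\big)-\sum_{i\in[d_1]}(1-\alpha_i)\ln(u_i/\alpha_i)$ be the barrier function of the dual cone $\mathcal{K}^*_{\mathrm{gpow}(\alpha,d_1,d_2)}$ of the generalized power cone, and let $z=(u,w)$ be in the interior of $\mathcal{K}^*_{\mathrm{gpow}(\alpha,d_1,d_2)}$. Then the Hessian $H^*(z)=\nabla^2f^*(z)$ is augmented-sparse with $n_1=1$, $n_2=2$; namely $$H^*(z)=D+pp^\top-qq^\top-rr^\top,\qquad D-qq^\top-rr^\top\succ0,$$ where, with $\varphi=\prod_{i\in[d_1]}(u_i/\alpha_i)^{2\alpha_i}$, $\zeta=\prod_{i\in[d_1]}(u_i/\alpha_i)^{2\alpha_i}-\|w\|^2$, and $\tau\in\mathbb{R}^{d_1}$, $\tau_i=2\alpha_i/u_i$ for all $i\in[d_1]$, $D$ is the diagonal matrix whose first $d_1$ diagonal entries are $\frac{\tau_i\varphi}{\zeta u_i}+\frac{1-\alpha_i}{u_i^2}$ $(i\in[d_1])$ and whose last $d_2$ diagonal entries are all $\frac{2}{\zeta}$, and $$p=\begin{bmatrix}p_0\,\tau/\zeta\\ p_1\,w/\zeta\end{bmatrix},\quad q=\begin{bmatrix}q_0\,\tau/\zeta\\0\end{bmatrix},\quad r=\begin{bmatrix}0\\ r_1\,w/\zeta\end{bmatrix},$$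 $$p_0=\sqrt{\frac{\varphi(\varphi+\|w\|^2)}{2}},\quad p_1=-2\sqrt{\frac{2\varphi}{\varphi+\|w\|^2}},\quad q_0=\sqrt{\frac{\zeta\varphi}{2}},\quad r_1=2\sqrt{\frac{\zeta}{\varphi+\|w\|^2}}.$$
   Context: $[d]=\{1,\dots,d\}$; $\mathbb{R}^d_+$ and $\mathbb{R}^d_{++}$ are the vectors with nonnegative, resp. positive, entries; $\|\cdot\|$ is the Euclidean norm. The generalized power cone is $\mathcal{K}_{\mathrm{gpow}(\alpha,d_1,d_2)}=\{(u,w)\in\mathbb{R}^{d_1}_+\times\mathbb{R}^{d_2}:\prod_{i\in[d_1]}u_i^{\alpha_i}\ge\|w\|\}$, and its dual cone is $\mathcal{K}^*_{\mathrm{gpow}(\alpha,d_1,d_2)}=\{(u,w)\in\mathbb{R}^{d_1}_+\times\mathbb{R}^{d_2}:\prod_{i\in[d_1]}(u_i/\alpha_i)^{\alpha_i}\ge\|w\|\}$. A matrix of the form $H=D+\sum_{i=1}^{n_1}u_iu_i^\top-\sum_{j=1}^{n_2}v_jv_j^\top$, with $D$ an $n\times n$ symmetric sparse matrix and $n_1,n_2\ll n$, is called augmented-sparse if $D-\sum_{j=1}^{n_2}v_jv_j^\top\succ0$ (positive definite).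
   Formalization: The positive definiteness of D − qq^T − rr^T, and hence augmented sparsity, is claimed only for d_1 ≥ 2, since for d_1 = 1 the u-diagonal entry is 2/ζ − 2/ζ = 0 and the matrix is singular; the Hessian formula is proved for all d_1 ≥ 1. *)

theory Defs
  imports "HOL-Analysis.Analysis"
begin

text \<open>The space of pairs \<open>(u, w)\<close> is \<open>real ^ ('m + 'n)\<close>, so that vectors and matrices on it
  have one index type. \<open>CARD('m)\<close> and \<open>CARD('n)\<close> are the dimensions \<open>d\<^sub>1\<close> and \<open>d\<^sub>2\<close>.\<close>

definition block_vec :: "real ^ 'm::finite \<Rightarrow> real ^ 'n::finite \<Rightarrow> real ^ ('m + 'n)" where
  "block_vec u w = (\<chi> k. case k of Inl i \<Rightarrow> u $ i | Inr j \<Rightarrow> w $ j)"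

definition fst_block :: "real ^ ('m::finite + 'n::finite) \<Rightarrow> real ^ 'm" where
  "fst_block z = (\<chi> i. z $ Inl i)"

definition snd_block :: "real ^ ('m::finite + 'n::finite) \<Rightarrow> real ^ 'n" where
  "snd_block z = (\<chi> j. z $ Inr j)"

lemma fst_block_block_vec [simp]: "fst_block (block_vec u w) = u"
  by (simp add: fst_block_def block_vec_def)

lemma snd_block_block_vec [simp]: "snd_block (block_vec u w) = w"
  by (simp add: snd_block_def block_vec_def)

lemma block_vec_collapse [simp]: "block_vec (fst_block z) (snd_block z) = z"
  by (auto simp: fst_block_def snd_block_def block_vec_def vec_eq_iff split: sum.splits)

lemma inner_block_vec:
  fixes u x :: "real ^ 'm::finite" and w y :: "real ^ 'n::finite"
  shows "block_vec u w \<bullet> block_vec x y = u \<bullet> x + w \<bullet> y"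
  by (simp add: inner_vec_def block_vec_def UNIV_Plus_UNIV[symmetric] sum.Plus
      del: UNIV_Plus_UNIV)

definition dual_cone :: "'a::real_inner set \<Rightarrow> 'a set" where
  "dual_cone K = {y. \<forall>x\<in>K. 0 \<le> y \<bullet> x}"

definition gpow_cone :: "real ^ 'm \<Rightarrow> (real ^ ('m::finite + 'n::finite)) set" where
  "gpow_cone \<alpha> = {block_vec u w | u w.
     (\<forall>i. 0 \<le> u $ i) \<and> norm w \<le> (\<Prod>i\<in>UNIV. (u $ i) powr (\<alpha> $ i))}"

definition gpow_dual_cone :: "real ^ 'm \<Rightarrow> (real ^ ('m::finite + 'n::finite)) set" where
  "gpow_dual_cone \<alpha> = {block_vec u w | u w.
     (\<forall>i. 0 \<le> u $ i) \<and> norm w \<le> (\<Prod>i\<in>UNIV. (u $ i / \<alpha> $ i) powr (\<alpha> $ i))}"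

lemma weighted_arith_geom_mean:
  fixes a x :: "'i::finite \<Rightarrow> real"
  assumes a: "\<And>i. 0 < a i" "sum a UNIV = 1" and x: "\<And>i. 0 \<le> x i"
  shows "(\<Prod>i\<in>UNIV. x i powr a i) \<le> (\<Sum>i\<in>UNIV. a i * x i)"
proof (cases "\<exists>i. x i = 0")
  case True
  then have "(\<Prod>i\<in>UNIV. x i powr a i) = 0"
    by (auto intro: prod_zero)
  moreover have "0 \<le> (\<Sum>i\<in>UNIV. a i * x i)"
    using a(1) x by (intro sum_nonneg mult_nonneg_nonneg) (auto simp: less_imp_le)
  ultimately show ?thesis by linarith
next
  case False
  then have x': "0 < x i" for i
    using x[of i] by (metis order_le_less)
  have "(\<Sum>i\<in>UNIV. a i * ln (x i)) \<le> ln (\<Sum>i\<in>UNIV. a i *\<^sub>R x i)"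
    using a x' by (intro concave_on_sum[OF _ _ ln_concave]) (auto simp: less_imp_le)
  moreover have "0 < (\<Sum>i\<in>UNIV. a i * x i)"
    using a(1) x' by (intro sum_pos mult_pos_pos) auto
  ultimately have "exp (\<Sum>i\<in>UNIV. a i * ln (x i)) \<le> (\<Sum>i\<in>UNIV. a i * x i)"
    by (simp add: ln_ge_iff)
  moreover have "exp (\<Sum>i\<in>UNIV. a i * ln (x i)) = (\<Prod>i\<in>UNIV. x i powr a i)"
    using x' by (auto simp: exp_sum powr_def less_imp_neq[THEN not_sym] intro!: prod.cong)
  ultimately show ?thesis by simp
qed

lemma dual_gpow_cone:
  fixes \<alpha> :: "real ^ 'm::finite"
  assumes \<alpha>: "\<And>i. 0 < \<alpha> $ i" "(\<Sum>i\<in>UNIV. \<alpha> $ i) = 1"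
  shows "dual_cone (gpow_cone \<alpha> :: (real ^ ('m + 'n::finite)) set) = gpow_dual_cone \<alpha>"
proof (intro set_eqI iffI)
  fix z :: "real ^ ('m + 'n)"
  assume "z \<in> gpow_dual_cone \<alpha>"
  then obtain u and w :: "real ^ 'n" where z: "z = block_vec u w" and u: "\<And>i. 0 \<le> u $ i"
    and w: "norm w \<le> (\<Prod>i\<in>UNIV. (u $ i / \<alpha> $ i) powr (\<alpha> $ i))"
    unfolding gpow_dual_cone_def by blast
  have "0 \<le> u \<bullet> x + w \<bullet> y"
    if x: "\<And>i. 0 \<le> x $ i" and y: "norm y \<le> (\<Prod>i\<in>UNIV. (x $ i) powr (\<alpha> $ i))"
    for x :: "real ^ 'm" and y :: "real ^ 'n"
  proof -
    have "\<bar>w \<bullet> y\<bar> \<le> norm w * norm y"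
      by (rule Cauchy_Schwarz_ineq2)
    also have "\<dots> \<le> (\<Prod>i\<in>UNIV. (u $ i / \<alpha> $ i) powr (\<alpha> $ i)) * (\<Prod>i\<in>UNIV. (x $ i) powr (\<alpha> $ i))"
      using w y by (intro mult_mono) (auto intro: prod_nonneg)
    also have "\<dots> = (\<Prod>i\<in>UNIV. (u $ i / \<alpha> $ i * x $ i) powr (\<alpha> $ i))"
      by (simp only: prod.distrib[symmetric] powr_mult[symmetric])
    also have "\<dots> \<le> (\<Sum>i\<in>UNIV. \<alpha> $ i * (u $ i / \<alpha> $ i * x $ i))"
      using u x \<alpha> by (intro weighted_arith_geom_mean) (auto simp: less_imp_le)
    also have "\<dots> = u \<bullet> x"
      unfolding inner_vec_def
      using \<alpha>(1) by (intro sum.cong) (auto simp: less_imp_neq[THEN not_sym])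
    finally show ?thesis by linarith
  qed
  then show "z \<in> dual_cone (gpow_cone \<alpha>)"
    unfolding dual_cone_def gpow_cone_def z by (auto simp: inner_block_vec)
next
  fix z :: "real ^ ('m + 'n)"
  assume "z \<in> dual_cone (gpow_cone \<alpha>)"
  moreover define u w where "u = fst_block z" and "w = snd_block z"
  then have z: "z = block_vec u w"
    by simp
  ultimately have dual: "0 \<le> u \<bullet> x + w \<bullet> y"
    if "\<And>i. 0 \<le> x $ i" "norm y \<le> (\<Prod>i\<in>UNIV. (x $ i) powr (\<alpha> $ i))"
    for x :: "real ^ 'm" and y :: "real ^ 'n"
  proof -
    have "block_vec x y \<in> gpow_cone \<alpha>"
      using that unfolding gpow_cone_def by blast
    then have "0 \<le> block_vec u w \<bullet> block_vec x y"
      using \<open>z \<in> dual_cone (gpow_cone \<alpha>)\<close> unfolding dual_cone_def z by blast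
    then show ?thesis
      by (simp only: inner_block_vec)
  qed
  have u: "0 \<le> u $ i" for i
    using dual[of "axis i 1" 0]
    by (simp add: inner_axis prod_nonneg) (simp add: axis_def)
  have eps: "norm w \<le> (\<Prod>i\<in>UNIV. ((u $ i + e) / \<alpha> $ i) powr (\<alpha> $ i))" if e: "0 < e" for e
  proof -
    define x :: "real ^ 'm" where "x = (\<chi> i. \<alpha> $ i / (u $ i + e))"
    define P where "P = (\<Prod>i\<in>UNIV. ((u $ i + e) / \<alpha> $ i) powr (\<alpha> $ i))"
    define c where "c = (\<Prod>i\<in>UNIV. (x $ i) powr (\<alpha> $ i))"
    have ue: "0 < u $ i + e" for i
      using u[of i] e by linarith
    have x: "0 < x $ i" for i
      using ue[of i] \<alpha>(1)[of i] by (simp add: x_def)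
    have c: "0 < c"
      unfolding c_def using x by (intro prod_pos) (auto simp: less_imp_neq[THEN not_sym])
    have "P * c = (\<Prod>i\<in>UNIV. ((u $ i + e) / \<alpha> $ i * x $ i) powr (\<alpha> $ i))"
      by (simp only: P_def c_def prod.distrib[symmetric] powr_mult[symmetric])
    also have "\<dots> = 1"
      using ue \<alpha>(1) by (simp add: x_def less_imp_neq[THEN not_sym])
    finally have Pc: "P * c = 1" .
    have "norm (- (c *\<^sub>R sgn w)) \<le> c"
      using c by (simp add: norm_sgn)
    then have "0 \<le> u \<bullet> x + w \<bullet> (- (c *\<^sub>R sgn w))"
      using x unfolding c_def by (intro dual) (auto simp: less_imp_le)
    also have "w \<bullet> (- (c *\<^sub>R sgn w)) = - (c * norm w)"
      by (cases "w = 0") (simp_all add: sgn_div_norm dot_square_norm power2_eq_square)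
    also have "u \<bullet> x \<le> (\<Sum>i\<in>UNIV. \<alpha> $ i)"
      unfolding inner_vec_def
    proof (intro sum_mono)
      fix i :: 'm
      show "u $ i \<bullet> x $ i \<le> \<alpha> $ i"
        using ue[of i] \<alpha>(1)[of i] e by (simp add: x_def field_simps)
    qed
    finally have "c * norm w \<le> P * c"
      using \<alpha>(2) Pc by simp
    then show ?thesis
      using c unfolding P_def[symmetric] by (simp add: mult.commute)
  qed
  have lim: "((\<lambda>e. \<Prod>i\<in>UNIV. ((u $ i + e) / \<alpha> $ i) powr (\<alpha> $ i))
      \<longlongrightarrow> (\<Prod>i\<in>UNIV. ((u $ i + 0) / \<alpha> $ i) powr (\<alpha> $ i))) (at_right 0)"
  proof (intro tendsto_prod tendsto_powr2 tendsto_intros)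
    fix i :: 'm
    show "\<alpha> $ i \<noteq> 0" "0 < \<alpha> $ i"
      using \<alpha>(1)[of i] by auto
    show "\<forall>\<^sub>F e in at_right 0. 0 \<le> (u $ i + e) / \<alpha> $ i"
      using u[of i] \<alpha>(1)[of i] by (auto simp: eventually_at_filter)
  qed
  have "norm w \<le> (\<Prod>i\<in>UNIV. ((u $ i + 0) / \<alpha> $ i) powr (\<alpha> $ i))"
    by (rule tendsto_lowerbound[OF lim]) (auto simp: eventually_at_filter eps)
  with u show "z \<in> gpow_dual_cone \<alpha>"
    unfolding gpow_dual_cone_def z by auto
qed

definition gpow_dual_barrier ::
    "real ^ 'm \<Rightarrow> real ^ ('m::finite + 'n::finite) \<Rightarrow> real" where
  "gpow_dual_barrier \<alpha> z = (let u = fst_block z; w = snd_block z in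
     - ln ((\<Prod>i\<in>UNIV. (u $ i / \<alpha> $ i) powr (2 * \<alpha> $ i)) - (norm w)\<^sup>2)
     - (\<Sum>i\<in>UNIV. (1 - \<alpha> $ i) * ln (u $ i / \<alpha> $ i)))"

text \<open>\<open>H\<close> is the matrix of the second Frechet derivative: \<open>f\<close> has a gradient \<open>g\<close> near \<open>z\<close>,
  and \<open>H\<close> is the Jacobian of \<open>g\<close> at \<open>z\<close>.\<close>

definition has_hessian :: "(real ^ 'n \<Rightarrow> real) \<Rightarrow> real ^ 'n ^ 'n \<Rightarrow> real ^ 'n::finite \<Rightarrow> bool" where
  "has_hessian f H z \<longleftrightarrow> (\<exists>g :: real ^ 'n \<Rightarrow> real ^ 'n.
     (\<forall>\<^sub>F y in nhds z. (f has_derivative (\<lambda>h. g y \<bullet> h)) (at y)) \<and>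
     (g has_derivative (\<lambda>h. H *v h)) (at z))"

lemma has_hessian_unique:
  assumes "has_hessian f H z" "has_hessian f H' z"
  shows "H = H'"
proof -
  obtain g where g: "\<forall>\<^sub>F y in nhds z. (f has_derivative (\<lambda>h. g y \<bullet> h)) (at y)"
    and gH: "(g has_derivative (\<lambda>h. H *v h)) (at z)"
    using assms(1) unfolding has_hessian_def by blast
  obtain g' where g': "\<forall>\<^sub>F y in nhds z. (f has_derivative (\<lambda>h. g' y \<bullet> h)) (at y)"
    and gH': "(g' has_derivative (\<lambda>h. H' *v h)) (at z)"
    using assms(2) unfolding has_hessian_def by blast
  have ev: "\<forall>\<^sub>F y in nhds z. g' y = g y"
    using g g'
  proof eventually_elim
    case (elim y)
    then have "(\<lambda>h. g y \<bullet> h) = (\<lambda>h. g' y \<bullet> h)"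
      by (rule has_derivative_unique)
    then show ?case
      by (auto simp: fun_eq_iff vector_eq_rdot)
  qed
  have "(g has_derivative (\<lambda>h. H' *v h)) (at z)"
    using gH' has_derivative_transform_eventually[of g' _ z UNIV g] ev
      eventually_nhds_x_imp_x[OF ev]
    by (simp add: eventually_nhds_conv_at)
  with gH have "(\<lambda>h. H *v h) = (\<lambda>h. H' *v h)"
    by (rule has_derivative_unique)
  then show ?thesis
    by (simp add: matrix_eq fun_eq_iff)
qed

definition outer_square :: "real ^ 'n \<Rightarrow> real ^ 'n ^ 'n" where
  "outer_square v = (\<chi> i j. v $ i * v $ j)"

definition diag_matrix :: "real ^ 'n \<Rightarrow> real ^ 'n ^ 'n" where
  "diag_matrix d = (\<chi> i j. if i = j then d $ i else 0)"

definition positive_definite :: "real ^ 'n ^ 'n::finite \<Rightarrow> bool" where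
  "positive_definite A \<longleftrightarrow> transpose A = A \<and> (\<forall>x. x \<noteq> 0 \<longrightarrow> 0 < x \<bullet> (A *v x))"

text \<open>The informal side conditions of augmented sparsity, that \<open>D\<close> is sparse and that the lists
  \<open>us\<close> and \<open>vs\<close> are short compared with the dimension, are not part of the predicate.\<close>

definition augmented_sparse ::
    "real ^ 'n ^ 'n::finite \<Rightarrow> real ^ 'n ^ 'n \<Rightarrow> (real ^ 'n) list \<Rightarrow> (real ^ 'n) list \<Rightarrow> bool" where
  "augmented_sparse H D us vs \<longleftrightarrow>
     transpose D = D \<and>
     H = D + (\<Sum>u\<leftarrow>us. outer_square u) - (\<Sum>v\<leftarrow>vs. outer_square v) \<and>
     positive_definite (D - (\<Sum>v\<leftarrow>vs. outer_square v))"

end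

theory Submission
  imports Defs
begin

text \<open>
  Write \<open>\<phi>(u) = \<Prod>i. (u\<^sub>i/\<alpha>\<^sub>i)\<^bsup>2\<alpha>\<^sub>i\<^esup>\<close> and \<open>\<zeta> = \<phi> - \<parallel>w\<parallel>\<^sup>2\<close>. The vector \<open>\<tau>\<close> with
  \<open>\<tau>\<^sub>i = 2\<alpha>\<^sub>i/u\<^sub>i\<close> is the gradient of \<open>ln \<phi>\<close>, so every derivative of \<open>\<phi>\<close> is again \<open>\<phi>\<close> times a
  polynomial in \<open>\<tau>\<close> and \<open>1/u\<close>. Differentiating the barrier twice gives a diagonal matrix plus a
  matrix on the span of \<open>(\<tau>, 0)\<close> and \<open>(0, w)\<close>, with coefficients \<open>\<phi>\<parallel>w\<parallel>\<^sup>2/\<zeta>\<^sup>2\<close> on \<open>\<tau>\<tau>\<^sup>T\<close>,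
  \<open>- 2\<phi>/\<zeta>\<^sup>2\<close> on the mixed terms and \<open>4/\<zeta>\<^sup>2\<close> on \<open>ww\<^sup>T\<close>. The numbers \<open>p\<^sub>0, p\<^sub>1, q\<^sub>0, r\<^sub>1\<close> solve
  \<open>p\<^sub>0\<^sup>2 - q\<^sub>0\<^sup>2 = \<phi>\<parallel>w\<parallel>\<^sup>2\<close>, \<open>p\<^sub>0p\<^sub>1 = - 2\<phi>\<close> and \<open>p\<^sub>1\<^sup>2 - r\<^sub>1\<^sup>2 = 4\<close>, so the single square \<open>pp\<^sup>T\<close>
  produces the mixed terms, and \<open>qq\<^sup>T\<close> and \<open>rr\<^sup>T\<close> correct the two diagonal blocks
  (lemma \<open>has_derivative_barrier_gradient\<close>).

  Because \<open>q\<close> and \<open>r\<close> live in different blocks, \<open>D - qq\<^sup>T - rr\<^sup>T\<close> is block diagonal and its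
  quadratic form splits. On the block of \<open>u\<close>, put \<open>y\<^sub>i = x\<^sub>i/u\<^sub>i\<close>; the form becomes
  \<open>(2\<phi>/\<zeta>) (\<Sum>\<alpha>\<^sub>iy\<^sub>i\<^sup>2 - (\<Sum>\<alpha>\<^sub>iy\<^sub>i)\<^sup>2) + \<Sum>(1 - \<alpha>\<^sub>i)y\<^sub>i\<^sup>2\<close>. The first part is a variance, and the second is
  positive as soon as all \<open>\<alpha>\<^sub>i < 1\<close>, which is what two or more coordinates guarantee. On the block
  of \<open>w\<close> the Cauchy-Schwarz inequality leaves a factor \<open>1 - 2\<parallel>w\<parallel>\<^sup>2/(\<phi> + \<parallel>w\<parallel>\<^sup>2) = \<zeta>/(\<phi> + \<parallel>w\<parallel>\<^sup>2)\<close>.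

  Everything takes place where \<open>u > 0\<close> and \<open>\<zeta> > 0\<close>; lemma \<open>interior_gpow_dual_cone\<close> shows that
  interior points of the dual cone satisfy this. As the interior is open, the gradient formula holds
  near each of its points, as \<open>has_hessian\<close> demands.
\<close>

section \<open>Vectors and matrices in block form\<close>

lemma linear_fst_block: "linear fst_block"
  by (rule linearI) (simp_all add: fst_block_def vec_eq_iff)

lemma linear_snd_block: "linear snd_block"
  by (rule linearI) (simp_all add: snd_block_def vec_eq_iff)

lemmas has_derivative_fst_block [derivative_intros] =
  bounded_linear.has_derivative[OF linear_conv_bounded_linear[THEN iffD1, OF linear_fst_block]]

lemmas has_derivative_snd_block [derivative_intros] =
  bounded_linear.has_derivative[OF linear_conv_bounded_linear[THEN iffD1, OF linear_snd_block]]

lemmas has_derivative_vec_nth [derivative_intros] =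
  bounded_linear.has_derivative[OF bounded_linear_vec_nth]

lemma block_vec_Inl [simp]: "block_vec u w $ Inl i = u $ i"
  by (simp add: block_vec_def)

lemma block_vec_Inr [simp]: "block_vec u w $ Inr j = w $ j"
  by (simp add: block_vec_def)

lemma all_block_index: "(\<forall>k::'m + 'n. P k) \<longleftrightarrow> (\<forall>i. P (Inl i)) \<and> (\<forall>j. P (Inr j))"
  by (metis sum.exhaust)

lemma has_derivative_vec_componentwise:
  fixes g :: "'a::real_normed_vector \<Rightarrow> real ^ 'k::finite"
  assumes "\<And>k. ((\<lambda>x. g x $ k) has_derivative (\<lambda>h. g' h $ k)) (at a)"
  shows "(g has_derivative g') (at a)"
  using assms
  by (subst has_derivative_componentwise_within) (auto simp: Basis_vec_def inner_axis)

lemma outer_square_mult_vec: "outer_square v *v x = (v \<bullet> x) *\<^sub>R v"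
  by (simp add: vec_eq_iff outer_square_def matrix_vector_mult_def inner_vec_def
      sum_distrib_left sum_distrib_right mult_ac)

lemma diag_matrix_mult_vec: "(diag_matrix d *v x) $ k = d $ k * x $ k"
proof -
  have "(diag_matrix d *v x) $ k = (\<Sum>j\<in>UNIV. if k = j then d $ k * x $ j else 0)"
    by (simp add: diag_matrix_def matrix_vector_mult_def if_distrib[of "\<lambda>c. c * _"] cong: if_cong)
  then show ?thesis by simp
qed

lemma transpose_outer_square [simp]: "transpose (outer_square v) = outer_square v"
  by (simp add: vec_eq_iff outer_square_def transpose_def mult.commute)

lemma transpose_diag_matrix [simp]: "transpose (diag_matrix d) = diag_matrix d"
  by (auto simp: vec_eq_iff diag_matrix_def transpose_def)

lemma transpose_diff: "transpose (A - B) = transpose A - transpose (B :: real ^ 'n ^ 'k)"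
  by (simp add: vec_eq_iff transpose_def)

lemma quadratic_form_diag_minus_squares:
  "x \<bullet> ((diag_matrix d - outer_square q - outer_square r) *v x)
     = (\<Sum>k\<in>UNIV. d $ k * (x $ k)\<^sup>2) - (q \<bullet> x)\<^sup>2 - (r \<bullet> x)\<^sup>2"
proof -
  have "x \<bullet> (diag_matrix d *v x) = (\<Sum>k\<in>UNIV. d $ k * (x $ k)\<^sup>2)"
    by (simp add: inner_vec_def diag_matrix_mult_vec power2_eq_square mult_ac)
  then show ?thesis
    by (simp add: matrix_vector_mult_diff_rdistrib inner_diff_right outer_square_mult_vec
        power2_eq_square inner_commute)
qed

section \<open>The interior of the dual cone\<close>

definition power_prod :: "real ^ 'm::finite \<Rightarrow> real ^ 'm \<Rightarrow> real" where
  "power_prod \<alpha> u = (\<Prod>i\<in>UNIV. (u $ i / \<alpha> $ i) powr (2 * \<alpha> $ i))"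

definition power_gap :: "real ^ 'm::finite \<Rightarrow> real ^ ('m + 'n::finite) \<Rightarrow> real" where
  "power_gap \<alpha> z = power_prod \<alpha> (fst_block z) - (norm (snd_block z))\<^sup>2"

lemma power_prod_eq_square:
  "power_prod \<alpha> u = (\<Prod>i\<in>UNIV. (u $ i / \<alpha> $ i) powr (\<alpha> $ i))\<^sup>2"
  unfolding power_prod_def
  by (simp only: mult_2 powr_add power2_eq_square prod.distrib)

lemma mem_gpow_dual_cone_iff:
  "z \<in> gpow_dual_cone \<alpha> \<longleftrightarrow> (\<forall>i. 0 \<le> fst_block z $ i) \<and>
     norm (snd_block z) \<le> (\<Prod>i\<in>UNIV. (fst_block z $ i / \<alpha> $ i) powr (\<alpha> $ i))"
proof
  assume "z \<in> gpow_dual_cone \<alpha>"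
  then show "(\<forall>i. 0 \<le> fst_block z $ i) \<and>
     norm (snd_block z) \<le> (\<Prod>i\<in>UNIV. (fst_block z $ i / \<alpha> $ i) powr (\<alpha> $ i))"
    unfolding gpow_dual_cone_def by auto
next
  assume "(\<forall>i. 0 \<le> fst_block z $ i) \<and>
     norm (snd_block z) \<le> (\<Prod>i\<in>UNIV. (fst_block z $ i / \<alpha> $ i) powr (\<alpha> $ i))"
  then show "z \<in> gpow_dual_cone \<alpha>"
    unfolding gpow_dual_cone_def
    by (intro CollectI exI[of _ "fst_block z"] exI[of _ "snd_block z"]) auto
qed

text \<open>An interior point can be moved a little towards each face without leaving the cone: lowering
  one coordinate of \<open>u\<close> gives positivity of \<open>u\<close>, and lengthening \<open>w\<close> makes the power inequality
  strict. The case \<open>w = 0\<close>, where \<open>w\<close> has no direction to be lengthened in, follows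
  from \<open>u > 0\<close>.\<close>

lemma interior_gpow_dual_cone:
  fixes z :: "real ^ ('m::finite + 'n::finite)"
  assumes \<alpha>: "\<And>i. 0 < \<alpha> $ i" and z: "z \<in> interior (gpow_dual_cone \<alpha>)"
  shows "0 < fst_block z $ i" and "0 < power_gap \<alpha> z"
proof -
  obtain e where e: "0 < e" and ball: "ball z e \<subseteq> gpow_dual_cone \<alpha>"
    using z unfolding mem_interior by blast
  show u: "0 < fst_block z $ i" for i
  proof -
    have "z - (e/2) *\<^sub>R axis (Inl i) 1 \<in> ball z e"
      using e by (simp add: dist_norm)
    then have "z - (e/2) *\<^sub>R axis (Inl i) 1 \<in> gpow_dual_cone \<alpha>"
      using ball by blast
    then have "0 \<le> fst_block (z - (e/2) *\<^sub>R axis (Inl i) 1) $ i"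
      unfolding mem_gpow_dual_cone_iff by blast
    then show ?thesis
      using e by (simp add: fst_block_def axis_def)
  qed
  define w where "w = snd_block z"
  define P where "P = (\<Prod>i\<in>UNIV. (fst_block z $ i / \<alpha> $ i) powr (\<alpha> $ i))"
  have "norm w < P"
  proof (cases "w = 0")
    case True
    have "0 < P"
      unfolding P_def using u \<alpha> by (intro prod_pos) (simp add: less_imp_neq[THEN not_sym])
    with True show ?thesis by simp
  next
    case False
    define y where "y = z + (e/2) *\<^sub>R block_vec 0 (sgn w)"
    have "norm (block_vec 0 (sgn w) :: real ^ ('m + 'n)) = norm (sgn w)"
      by (simp add: norm_eq_sqrt_inner inner_block_vec)
    then have "y \<in> ball z e"
      using e False by (simp add: y_def dist_norm norm_sgn)
    then have "y \<in> gpow_dual_cone \<alpha>"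
      using ball by blast
    moreover have "fst_block y = fst_block z"
      by (simp add: y_def fst_block_def vec_eq_iff)
    moreover have "snd_block y = w + (e/2) *\<^sub>R sgn w"
      by (simp add: y_def w_def snd_block_def vec_eq_iff)
    moreover have "norm (w + (e/2) *\<^sub>R sgn w) = norm w + e/2"
    proof -
      have "w + (e/2) *\<^sub>R sgn w = (1 + e/2 * inverse (norm w)) *\<^sub>R w"
        by (simp add: sgn_div_norm scaleR_add_left)
      then have "norm (w + (e/2) *\<^sub>R sgn w) = \<bar>1 + e/2 * inverse (norm w)\<bar> * norm w"
        by (simp only: norm_scaleR)
      also have "\<bar>1 + e/2 * inverse (norm w)\<bar> = 1 + e/2 * inverse (norm w)"
        using e by simp
      also have "\<dots> * norm w = norm w + e/2"
        using False by (simp add: distrib_right)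
      finally show ?thesis .
    qed
    ultimately have "norm w + e/2 \<le> P"
      unfolding mem_gpow_dual_cone_iff P_def by simp
    with e show ?thesis by simp
  qed
  then show "0 < power_gap \<alpha> z"
    unfolding power_gap_def power_prod_eq_square P_def[symmetric] w_def[symmetric]
    by (simp add: power_strict_mono)
qed

section \<open>First and second derivatives of the barrier\<close>

definition log_gradient :: "real ^ 'm::finite \<Rightarrow> real ^ 'm \<Rightarrow> real ^ 'm" where
  "log_gradient \<alpha> u = (\<chi> i. 2 * \<alpha> $ i / u $ i)"

text \<open>Each factor has relative derivative \<open>2\<alpha>\<^sub>i/u\<^sub>i\<close>, and relative derivatives of factors add up in a
  product. Positivity of \<open>u\<close> makes the real powers differentiable.\<close>

lemma has_derivative_power_prod:
  assumes \<alpha>: "\<And>i. 0 < \<alpha> $ i" and u: "\<And>i. 0 < u $ i"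
  shows "(power_prod \<alpha> has_derivative (\<lambda>h. power_prod \<alpha> u * (log_gradient \<alpha> u \<bullet> h))) (at u)"
proof -
  define F where "F i v = (v $ i / \<alpha> $ i) powr (2 * \<alpha> $ i)" for i and v :: "real ^ 'a"
  have "(F i has_derivative (\<lambda>h. log_gradient \<alpha> u $ i * h $ i * F i u)) (at u)" for i
    unfolding F_def
    using \<alpha>[of i] u[of i]
    by (auto intro!: derivative_eq_intros simp: log_gradient_def field_simps)
  then have "((\<lambda>v. \<Prod>i\<in>UNIV. F i v) has_derivative
      (\<lambda>h. \<Sum>i\<in>UNIV. log_gradient \<alpha> u $ i * h $ i * F i u * (\<Prod>j\<in>UNIV - {i}. F j u))) (at u)"
    by (rule has_derivative_prod)
  moreover have "log_gradient \<alpha> u $ i * h $ i * F i u * (\<Prod>j\<in>UNIV - {i}. F j u)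
      = power_prod \<alpha> u * (log_gradient \<alpha> u $ i * h $ i)" for i h
    using prod.remove[of UNIV i "\<lambda>j. F j u"] by (simp add: power_prod_def F_def)
  ultimately show ?thesis
    unfolding power_prod_def[abs_def] F_def
    by (simp add: inner_vec_def sum_distrib_left)
qed

lemma has_derivative_power_prod_fst_block:
  assumes \<alpha>: "\<And>i. 0 < \<alpha> $ i" and u: "\<And>i. 0 < fst_block z $ i"
  shows "((\<lambda>z. power_prod \<alpha> (fst_block z)) has_derivative
    (\<lambda>h. power_prod \<alpha> (fst_block z) * (log_gradient \<alpha> (fst_block z) \<bullet> fst_block h))) (at z)"
  by (rule has_derivative_compose[OF has_derivative_fst_block[OF has_derivative_ident]
        has_derivative_power_prod[OF \<alpha> u]])

lemma has_derivative_power_gap: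
  fixes z :: "real ^ ('m::finite + 'n::finite)"
  assumes \<alpha>: "\<And>i. 0 < \<alpha> $ i" and u: "\<And>i. 0 < fst_block z $ i"
  shows "(power_gap \<alpha> has_derivative
    (\<lambda>h. power_prod \<alpha> (fst_block z) * (log_gradient \<alpha> (fst_block z) \<bullet> fst_block h)
         - 2 * (snd_block z \<bullet> snd_block h))) (at z)"
proof -
  have snd: "((\<lambda>z::real ^ ('m + 'n). snd_block z) has_derivative (\<lambda>h. snd_block h)) (at z)"
    by (rule has_derivative_snd_block[OF has_derivative_ident])
  have "((\<lambda>z::real ^ ('m + 'n). snd_block z \<bullet> snd_block z) has_derivative
      (\<lambda>h. 2 * (snd_block z \<bullet> snd_block h))) (at z)"
    using has_derivative_inner[OF snd snd] by (simp add: inner_commute)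
  then show ?thesis
    unfolding power_gap_def[abs_def] power2_norm_eq_inner
    by (intro has_derivative_diff has_derivative_power_prod_fst_block \<alpha> u)
qed

definition barrier_gradient ::
    "real ^ 'm::finite \<Rightarrow> real ^ ('m + 'n::finite) \<Rightarrow> real ^ ('m + 'n)" where
  "barrier_gradient \<alpha> z = block_vec
     (\<chi> i. - (power_prod \<alpha> (fst_block z) * (2 * \<alpha> $ i / fst_block z $ i) / power_gap \<alpha> z)
           - (1 - \<alpha> $ i) / fst_block z $ i)
     ((2 / power_gap \<alpha> z) *\<^sub>R snd_block z)"

lemma has_derivative_barrier:
  fixes z :: "real ^ ('m::finite + 'n::finite)"
  assumes \<alpha>: "\<And>i. 0 < \<alpha> $ i" and u: "\<And>i. 0 < fst_block z $ i" and gap: "0 < power_gap \<alpha> z"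
  shows "(gpow_dual_barrier \<alpha> has_derivative (\<lambda>h. barrier_gradient \<alpha> z \<bullet> h)) (at z)"
proof -
  define \<Phi> where "\<Phi> = power_prod \<alpha> (fst_block z)"
  define Z where "Z = power_gap \<alpha> z"
  have barrier: "gpow_dual_barrier \<alpha> = (\<lambda>y::real ^ ('m + 'n). - ln (power_gap \<alpha> y)
      - (\<Sum>i\<in>UNIV. (1 - \<alpha> $ i) * ln (y $ Inl i / \<alpha> $ i)))"
    by (simp add: fun_eq_iff gpow_dual_barrier_def power_gap_def power_prod_def Let_def
        fst_block_def)
  have u': "0 < z $ Inl i" for i
    using u[of i] by (simp add: fst_block_def)
  have logs: "((\<lambda>y. \<Sum>i\<in>UNIV. (1 - \<alpha> $ i) * ln (y $ Inl i / \<alpha> $ i)) has_derivative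
      (\<lambda>h. \<Sum>i\<in>UNIV. (1 - \<alpha> $ i) / z $ Inl i * h $ Inl i)) (at z)"
  proof (rule has_derivative_sum)
    fix i
    show "((\<lambda>y. (1 - \<alpha> $ i) * ln (y $ Inl i / \<alpha> $ i)) has_derivative
        (\<lambda>h. (1 - \<alpha> $ i) / z $ Inl i * h $ Inl i)) (at z)"
      using \<alpha>[of i] u'[of i]
      by (auto intro!: derivative_eq_intros simp: field_simps)
  qed
  have "((\<lambda>y. ln (power_gap \<alpha> y)) has_derivative
      (\<lambda>h. (\<Phi> * (log_gradient \<alpha> (fst_block z) \<bullet> fst_block h)
            - 2 * (snd_block z \<bullet> snd_block h)) / Z)) (at z)"
    using DERIV_compose_FDERIV[OF DERIV_ln[OF gap] has_derivative_power_gap[OF \<alpha> u]]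
    by (simp add: \<Phi>_def Z_def divide_inverse)
  then have "(gpow_dual_barrier \<alpha> has_derivative
      (\<lambda>h. - ((\<Phi> * (log_gradient \<alpha> (fst_block z) \<bullet> fst_block h)
            - 2 * (snd_block z \<bullet> snd_block h)) / Z)
         - (\<Sum>i\<in>UNIV. (1 - \<alpha> $ i) / z $ Inl i * h $ Inl i))) (at z)"
    unfolding barrier by (intro has_derivative_diff has_derivative_minus logs)
  moreover have "barrier_gradient \<alpha> z \<bullet> h =
      - ((\<Phi> * (log_gradient \<alpha> (fst_block z) \<bullet> fst_block h)
            - 2 * (snd_block z \<bullet> snd_block h)) / Z)
         - (\<Sum>i\<in>UNIV. (1 - \<alpha> $ i) / z $ Inl i * h $ Inl i)" for h
  proof -
    have "barrier_gradient \<alpha> z \<bullet> h = barrier_gradient \<alpha> z \<bullet> block_vec (fst_block h) (snd_block h)"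
      by simp
    also have "\<dots> = (\<Sum>i\<in>UNIV. (- (\<Phi> / Z * (log_gradient \<alpha> (fst_block z) $ i * fst_block h $ i))
             - (1 - \<alpha> $ i) / z $ Inl i * h $ Inl i))
          + 2 / Z * (snd_block z \<bullet> snd_block h)"
      unfolding barrier_gradient_def inner_block_vec \<Phi>_def[symmetric] Z_def[symmetric]
      by (simp add: inner_vec_def[where 'b = 'm] log_gradient_def fst_block_def algebra_simps)
    also have "\<dots> = - (\<Phi> / Z * (log_gradient \<alpha> (fst_block z) \<bullet> fst_block h))
          - (\<Sum>i\<in>UNIV. (1 - \<alpha> $ i) / z $ Inl i * h $ Inl i)
          + 2 / Z * (snd_block z \<bullet> snd_block h)"
      by (simp add: sum_subtractf sum_negf sum_distrib_left inner_vec_def)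
    finally show ?thesis
      by (simp add: diff_divide_distrib)
  qed
  ultimately show ?thesis by simp
qed

text \<open>The second derivative sees \<open>p\<^sub>0, p\<^sub>1, q\<^sub>0, r\<^sub>1\<close> only through the coefficients that
  \<open>\<tau>\<tau>\<^sup>T\<close>, \<open>\<tau>w\<^sup>T\<close> and \<open>ww\<^sup>T\<close> have in \<open>pp\<^sup>T - qq\<^sup>T - rr\<^sup>T\<close>. The assumptions fix just these
  three coefficients, which keeps square roots out of the differentiation.\<close>

lemma has_derivative_barrier_gradient:
  fixes u \<tau> :: "real ^ 'm::finite" and w :: "real ^ 'n::finite"
  assumes \<alpha>: "\<And>i. 0 < \<alpha> $ i" and u: "\<And>i. 0 < u $ i" and gap: "0 < \<zeta>"
    and \<zeta>: "\<zeta> = power_gap \<alpha> (block_vec u w)" and \<phi>: "\<phi> = power_prod \<alpha> u"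
    and \<tau>: "\<tau> = log_gradient \<alpha> u"
    and D: "D = diag_matrix (block_vec
              (\<chi> i. \<tau> $ i * \<phi> / (\<zeta> * u $ i) + (1 - \<alpha> $ i) / (u $ i)\<^sup>2)
              (\<chi> j. 2 / \<zeta>))"
    and p: "p = block_vec ((p\<^sub>0 / \<zeta>) *\<^sub>R \<tau>) ((p\<^sub>1 / \<zeta>) *\<^sub>R w)"
    and q: "q = block_vec ((q\<^sub>0 / \<zeta>) *\<^sub>R \<tau>) 0"
    and r: "r = block_vec 0 ((r\<^sub>1 / \<zeta>) *\<^sub>R w)"
    and uu: "p\<^sub>0\<^sup>2 - q\<^sub>0\<^sup>2 = \<phi> * (\<phi> - \<zeta>)" and uw: "p\<^sub>0 * p\<^sub>1 = - 2 * \<phi>" and ww: "p\<^sub>1\<^sup>2 - r\<^sub>1\<^sup>2 = 4"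
  shows "(barrier_gradient \<alpha> has_derivative
    (\<lambda>h. (D + outer_square p - outer_square q - outer_square r) *v h)) (at (block_vec u w))"
proof (rule has_derivative_vec_componentwise)
  fix k :: "'m + 'n"
  let ?z = "block_vec u w"
  let ?H = "D + outer_square p - outer_square q - outer_square r"
  have pos: "0 < power_gap \<alpha> ?z" "0 < fst_block ?z $ i" for i
    using gap \<zeta> u by simp_all
  have mult: "?H *v h = D *v h + (p \<bullet> h) *\<^sub>R p - (q \<bullet> h) *\<^sub>R q - (r \<bullet> h) *\<^sub>R r" for h
    by (simp add: matrix_vector_mult_diff_rdistrib matrix_vector_mult_add_rdistrib
        outer_square_mult_vec)
  have inner: "v = block_vec x y \<Longrightarrow> v \<bullet> h = x \<bullet> fst_block h + y \<bullet> snd_block h"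
    for v h :: "real ^ ('m + 'n)" and x y
    by (metis block_vec_collapse inner_block_vec)
  note dprod = has_derivative_power_prod_fst_block[OF \<alpha> pos(2)]
  have dgap: "((\<lambda>z. inverse (power_gap \<alpha> z)) has_derivative
      (\<lambda>h. - (\<phi> * (\<tau> \<bullet> fst_block h) - 2 * (w \<bullet> snd_block h)) / \<zeta>\<^sup>2)) (at ?z)"
    using Deriv.has_derivative_inverse[OF _ has_derivative_power_gap[OF \<alpha> pos(2)]] gap
    by (simp add: \<phi>[symmetric] \<zeta>[symmetric] \<tau>[symmetric] power2_eq_square divide_inverse
        mult_ac right_diff_distrib)
  show "((\<lambda>z. barrier_gradient \<alpha> z $ k) has_derivative (\<lambda>h. (?H *v h) $ k)) (at ?z)"
  proof (cases k)
    case (Inl i)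
    have H: "(?H *v h) $ Inl i = (\<tau> $ i * \<phi> / (\<zeta> * u $ i) + (1 - \<alpha> $ i) / (u $ i)\<^sup>2) * h $ Inl i
        + ((p\<^sub>0\<^sup>2 - q\<^sub>0\<^sup>2) * (\<tau> \<bullet> fst_block h) + p\<^sub>0 * p\<^sub>1 * (w \<bullet> snd_block h)) * \<tau> $ i / \<zeta>\<^sup>2" for h
    proof -
      have "(?H *v h) $ Inl i = (\<tau> $ i * \<phi> / (\<zeta> * u $ i) + (1 - \<alpha> $ i) / (u $ i)\<^sup>2) * h $ Inl i
          + (p\<^sub>0 / \<zeta> * (\<tau> \<bullet> fst_block h) + p\<^sub>1 / \<zeta> * (w \<bullet> snd_block h)) * (p\<^sub>0 / \<zeta> * \<tau> $ i)
          - q\<^sub>0 / \<zeta> * (\<tau> \<bullet> fst_block h) * (q\<^sub>0 / \<zeta> * \<tau> $ i)"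
        unfolding mult vector_add_component vector_minus_component vector_scaleR_component
          inner[OF p] inner[OF q] inner[OF r]
        by (simp add: D p q r diag_matrix_mult_vec)
      moreover have "(p\<^sub>0 / \<zeta> * T + p\<^sub>1 / \<zeta> * W) * (p\<^sub>0 / \<zeta> * t) - q\<^sub>0 / \<zeta> * T * (q\<^sub>0 / \<zeta> * t)
          = ((p\<^sub>0\<^sup>2 - q\<^sub>0\<^sup>2) * T + p\<^sub>0 * p\<^sub>1 * W) * t / \<zeta>\<^sup>2" for T W t
        using gap by (simp add: field_simps power2_eq_square)
      ultimately show ?thesis
        by (simp only: add_diff_eq[symmetric])
    qed
    have grad: "barrier_gradient \<alpha> z $ Inl i
        = - (power_prod \<alpha> (fst_block z) * (2 * \<alpha> $ i / z $ Inl i) * inverse (power_gap \<alpha> z))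
          - (1 - \<alpha> $ i) / z $ Inl i" for z
      by (simp add: barrier_gradient_def fst_block_def divide_inverse)
    have recip: "((\<lambda>z. c / z $ Inl i) has_derivative (\<lambda>h. - (c / (u $ i)\<^sup>2 * h $ Inl i))) (at ?z)"
      for c
      using u[of i] by (auto intro!: derivative_eq_intros simp: field_simps power2_eq_square)
    (* turns the numerators produced by the quotient rule back into multiples of \<tau> *)
    have \<alpha>i: "2 * \<alpha> $ i = \<tau> $ i * u $ i"
      using u[of i] by (simp add: \<tau> log_gradient_def)
    have "((\<lambda>z. barrier_gradient \<alpha> z $ Inl i) has_derivative
        (\<lambda>h. - (\<phi> * \<tau> $ i * (- (\<phi> * (\<tau> \<bullet> fst_block h) - 2 * (w \<bullet> snd_block h)) / \<zeta>\<^sup>2)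
              + (\<phi> * - (\<tau> $ i * u $ i / (u $ i)\<^sup>2 * h $ Inl i)
                 + \<phi> * (\<tau> \<bullet> fst_block h) * \<tau> $ i) * inverse \<zeta>)
            - - ((1 - \<alpha> $ i) / (u $ i)\<^sup>2 * h $ Inl i))) (at ?z)"
      unfolding grad
      using has_derivative_diff[OF has_derivative_minus[OF has_derivative_mult[OF
            has_derivative_mult[OF dprod recip[of "2 * \<alpha> $ i"]] dgap]] recip[of "1 - \<alpha> $ i"]] u[of i]
      by (simp add: \<phi>[symmetric] \<zeta>[symmetric] \<tau>[symmetric] \<alpha>i)
    moreover have "- (\<phi> * t * (- (\<phi> * T - 2 * W) / \<zeta>\<^sup>2)
              + (\<phi> * - (t * v / v\<^sup>2 * x) + \<phi> * T * t) * inverse \<zeta>) - - (a / v\<^sup>2 * x)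
        = (t * \<phi> / (\<zeta> * v) + a / v\<^sup>2) * x + (\<phi> * (\<phi> - \<zeta>) * T + - 2 * \<phi> * W) * t / \<zeta>\<^sup>2"
      if "0 < v" for t T W v x a :: real
      using that gap by (simp add: field_simps power2_eq_square)
    ultimately show ?thesis
      unfolding Inl H uu uw using u[of i] by simp
  next
    case (Inr j)
    have H: "(?H *v h) $ Inr j = 2 / \<zeta> * h $ Inr j
        + (p\<^sub>0 * p\<^sub>1 * (\<tau> \<bullet> fst_block h) + (p\<^sub>1\<^sup>2 - r\<^sub>1\<^sup>2) * (w \<bullet> snd_block h)) * w $ j / \<zeta>\<^sup>2" for h
    proof -
      have "(?H *v h) $ Inr j = 2 / \<zeta> * h $ Inr j
          + (p\<^sub>0 / \<zeta> * (\<tau> \<bullet> fst_block h) + p\<^sub>1 / \<zeta> * (w \<bullet> snd_block h)) * (p\<^sub>1 / \<zeta> * w $ j)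
          - r\<^sub>1 / \<zeta> * (w \<bullet> snd_block h) * (r\<^sub>1 / \<zeta> * w $ j)"
        unfolding mult vector_add_component vector_minus_component vector_scaleR_component
          inner[OF p] inner[OF q] inner[OF r]
        by (simp add: D p q r diag_matrix_mult_vec)
      moreover have "(p\<^sub>0 / \<zeta> * T + p\<^sub>1 / \<zeta> * W) * (p\<^sub>1 / \<zeta> * t) - r\<^sub>1 / \<zeta> * W * (r\<^sub>1 / \<zeta> * t)
          = (p\<^sub>0 * p\<^sub>1 * T + (p\<^sub>1\<^sup>2 - r\<^sub>1\<^sup>2) * W) * t / \<zeta>\<^sup>2" for T W t
        using gap by (simp add: field_simps power2_eq_square)
      ultimately show ?thesis
        by (simp only: add_diff_eq[symmetric])
    qed
    have grad: "barrier_gradient \<alpha> z $ Inr j = 2 * z $ Inr j * inverse (power_gap \<alpha> z)" for z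
      by (simp add: barrier_gradient_def snd_block_def divide_inverse)
    have "((\<lambda>z. barrier_gradient \<alpha> z $ Inr j) has_derivative
        (\<lambda>h. 2 * w $ j * (- (\<phi> * (\<tau> \<bullet> fst_block h) - 2 * (w \<bullet> snd_block h)) / \<zeta>\<^sup>2)
              + 2 * h $ Inr j * inverse \<zeta>)) (at ?z)"
      unfolding grad
      using has_derivative_mult[OF has_derivative_mult_right[OF
            has_derivative_vec_nth[OF has_derivative_ident], of 2 "Inr j"] dgap]
      by (simp add: \<zeta>[symmetric])
    moreover have "2 * v * (- (\<phi> * T - 2 * W) / \<zeta>\<^sup>2) + 2 * x * inverse \<zeta>
        = 2 / \<zeta> * x + (- 2 * \<phi> * T + 4 * W) * v / \<zeta>\<^sup>2" for v T W x :: real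
      using gap by (simp add: field_simps power2_eq_square)
    ultimately show ?thesis
      unfolding Inr H uw ww by simp
  qed
qed

section \<open>Positive definiteness\<close>

lemma weighted_square_mean_le:
  fixes a y :: "'i::finite \<Rightarrow> real"
  assumes "\<And>i. 0 \<le> a i" "sum a UNIV = 1"
  shows "(\<Sum>i\<in>UNIV. a i * y i)\<^sup>2 \<le> (\<Sum>i\<in>UNIV. a i * (y i)\<^sup>2)"
  using convex_on_sum[OF finite_class.finite_UNIV _ convex_power2, of a y] assms by simp

lemma weight_less_one:
  fixes a :: "'i::finite \<Rightarrow> real"
  assumes pos: "\<And>i. 0 < a i" and sum: "sum a UNIV = 1" and card: "2 \<le> CARD('i)"
  shows "a i < 1"
proof -
  have "UNIV - {i} \<noteq> {}"
    using card by (metis Diff_eq_empty_iff card_mono card.insert card.empty finite.emptyI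
        finite_insert insert_absorb empty_iff not_less_eq_eq numeral_2_eq_2)
  then have "0 < sum a (UNIV - {i})"
    using pos by (intro sum_pos) auto
  then show ?thesis
    using sum sum.remove[of UNIV i a] by simp
qed

text \<open>The block of \<open>u\<close>: after the substitution \<open>y\<^sub>i = x\<^sub>i/u\<^sub>i\<close>, the subtracted square is at most
  the \<open>\<phi>/\<zeta>\<close> part of the diagonal by Jensen, and the rest of the diagonal stays.\<close>

lemma first_block_form_ge:
  fixes \<alpha> u x :: "real ^ 'm::finite"
  assumes \<alpha>: "\<And>i. 0 < \<alpha> $ i" "(\<Sum>i\<in>UNIV. \<alpha> $ i) = 1" and u: "\<And>i. 0 < u $ i"
    and pos: "0 < \<phi>" "0 < \<zeta>" and \<tau>: "\<tau> = log_gradient \<alpha> u"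
  shows "(\<Sum>i\<in>UNIV. (1 - \<alpha> $ i) * (x $ i / u $ i)\<^sup>2)
    \<le> (\<Sum>i\<in>UNIV. (\<tau> $ i * \<phi> / (\<zeta> * u $ i) + (1 - \<alpha> $ i) / (u $ i)\<^sup>2) * (x $ i)\<^sup>2)
        - \<phi> / (2 * \<zeta>) * (\<tau> \<bullet> x)\<^sup>2"
proof -
  define y where "y i = x $ i / u $ i" for i
  have "\<tau> \<bullet> x = 2 * (\<Sum>i\<in>UNIV. \<alpha> $ i * y i)"
    by (simp add: \<tau> log_gradient_def inner_vec_def y_def sum_distrib_left mult_ac)
  then have "\<phi> / (2 * \<zeta>) * (\<tau> \<bullet> x)\<^sup>2 = 2 * \<phi> / \<zeta> * (\<Sum>i\<in>UNIV. \<alpha> $ i * y i)\<^sup>2"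
    by (simp add: power_mult_distrib)
  also have "\<dots> \<le> 2 * \<phi> / \<zeta> * (\<Sum>i\<in>UNIV. \<alpha> $ i * (y i)\<^sup>2)"
    using pos \<alpha> by (intro mult_left_mono weighted_square_mean_le) (auto simp: less_imp_le)
  also have "\<dots> = (\<Sum>i\<in>UNIV. \<tau> $ i * \<phi> / (\<zeta> * u $ i) * (x $ i)\<^sup>2)"
    by (simp add: \<tau> log_gradient_def y_def sum_distrib_left power2_eq_square mult_ac)
  finally show ?thesis
    by (simp add: distrib_right sum.distrib power_divide)
qed

text \<open>The block of \<open>w\<close>: the worst direction for the subtracted square is \<open>w\<close> itself, and there the
  definition of \<open>\<zeta>\<close>, read as \<open>2\<parallel>w\<parallel>\<^sup>2 = (\<phi> + \<parallel>w\<parallel>\<^sup>2) - \<zeta>\<close>, shows that the multiple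
  \<open>\<zeta>/(\<phi> + \<parallel>w\<parallel>\<^sup>2)\<close> of the diagonal survives.\<close>

lemma second_block_form_ge:
  fixes w y :: "'a::real_inner"
  assumes pos: "0 < \<phi>" "0 < \<zeta>" and \<zeta>: "\<zeta> = \<phi> - (norm w)\<^sup>2"
  shows "2 / (\<phi> + (norm w)\<^sup>2) * (norm y)\<^sup>2
    \<le> 2 / \<zeta> * (norm y)\<^sup>2 - 4 / (\<zeta> * (\<phi> + (norm w)\<^sup>2)) * (w \<bullet> y)\<^sup>2"
proof -
  define s where "s = \<phi> + (norm w)\<^sup>2"
  have s: "0 < s" unfolding s_def using pos by (simp add: add_pos_nonneg)
  have "(w \<bullet> y)\<^sup>2 \<le> (norm w)\<^sup>2 * (norm y)\<^sup>2"
    using Cauchy_Schwarz_ineq[of w y] by (simp add: power2_norm_eq_inner)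
  then have "4 / (\<zeta> * s) * (w \<bullet> y)\<^sup>2 \<le> 4 / (\<zeta> * s) * ((norm w)\<^sup>2 * (norm y)\<^sup>2)"
    using pos s by (intro mult_left_mono) auto
  also have "(norm w)\<^sup>2 = (s - \<zeta>) / 2"
    by (simp add: s_def \<zeta>)
  also have "4 / (\<zeta> * s) * ((s - \<zeta>) / 2 * (norm y)\<^sup>2) = 2 / \<zeta> * (norm y)\<^sup>2 - 2 / s * (norm y)\<^sup>2"
    using pos s by (simp add: field_simps)
  finally show ?thesis unfolding s_def by simp
qed

lemma positive_definite_barrier_part:
  fixes \<alpha> u \<tau> :: "real ^ 'm::finite" and w :: "real ^ 'n::finite"
  assumes \<alpha>: "\<And>i. 0 < \<alpha> $ i" "(\<Sum>i\<in>UNIV. \<alpha> $ i) = 1" and card: "2 \<le> CARD('m)"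
    and u: "\<And>i. 0 < u $ i" and pos: "0 < \<phi>" "0 < \<zeta>" and \<zeta>: "\<zeta> = \<phi> - (norm w)\<^sup>2"
    and \<tau>: "\<tau> = log_gradient \<alpha> u"
    and D: "D = diag_matrix (block_vec
              (\<chi> i. \<tau> $ i * \<phi> / (\<zeta> * u $ i) + (1 - \<alpha> $ i) / (u $ i)\<^sup>2)
              (\<chi> j. 2 / \<zeta>))"
    and q: "q = block_vec ((q\<^sub>0 / \<zeta>) *\<^sub>R \<tau>) 0"
    and r: "r = block_vec 0 ((r\<^sub>1 / \<zeta>) *\<^sub>R w)"
    and q\<^sub>0: "q\<^sub>0\<^sup>2 = \<zeta> * \<phi> / 2" and r\<^sub>1: "r\<^sub>1\<^sup>2 = 4 * \<zeta> / (\<phi> + (norm w)\<^sup>2)"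
  shows "positive_definite (D - outer_square q - outer_square r)"
  unfolding positive_definite_def
proof (intro conjI allI impI)
  show "transpose (D - outer_square q - outer_square r) = D - outer_square q - outer_square r"
    by (simp add: D transpose_diff)
next
  fix h :: "real ^ ('m + 'n)"
  assume "h \<noteq> 0"
  define x where "x = fst_block h"
  define y where "y = snd_block h"
  have h: "h = block_vec x y"
    by (simp add: x_def y_def)
  have "x \<noteq> 0 \<or> y \<noteq> 0"
    using \<open>h \<noteq> 0\<close> by (auto simp: h vec_eq_iff all_block_index)
  have first: "0 \<le> (1 - \<alpha> $ i) * (x $ i / u $ i)\<^sup>2" for i
    using weight_less_one[OF \<alpha> card, of i] by simp
  have "0 < (\<Sum>i\<in>UNIV. (1 - \<alpha> $ i) * (x $ i / u $ i)\<^sup>2) + 2 / (\<phi> + (norm w)\<^sup>2) * (norm y)\<^sup>2"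
  proof (cases "x = 0")
    case True
    then show ?thesis
      using \<open>x \<noteq> 0 \<or> y \<noteq> 0\<close> pos by (simp add: add_pos_nonneg)
  next
    case False
    then obtain i where "x $ i \<noteq> 0"
      by (auto simp: vec_eq_iff)
    then have "0 < (1 - \<alpha> $ i) * (x $ i / u $ i)\<^sup>2"
      using weight_less_one[OF \<alpha> card, of i] u[of i] by simp
    then have "0 < (\<Sum>i\<in>UNIV. (1 - \<alpha> $ i) * (x $ i / u $ i)\<^sup>2)"
      using first by (intro sum_pos2[of UNIV i]) auto
    then show ?thesis
      using pos by (intro add_pos_nonneg) auto
  qed
  also have "\<dots> \<le> (\<Sum>i\<in>UNIV. (\<tau> $ i * \<phi> / (\<zeta> * u $ i) + (1 - \<alpha> $ i) / (u $ i)\<^sup>2) * (x $ i)\<^sup>2)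
        - \<phi> / (2 * \<zeta>) * (\<tau> \<bullet> x)\<^sup>2
        + (2 / \<zeta> * (norm y)\<^sup>2 - 4 / (\<zeta> * (\<phi> + (norm w)\<^sup>2)) * (w \<bullet> y)\<^sup>2)"
    by (intro add_mono first_block_form_ge second_block_form_ge \<alpha> u pos \<tau> \<zeta>)
  also have "\<dots> = h \<bullet> ((D - outer_square q - outer_square r) *v h)"
  proof -
    have "(q \<bullet> h)\<^sup>2 = \<phi> / (2 * \<zeta>) * (\<tau> \<bullet> x)\<^sup>2"
      unfolding q h inner_block_vec
      using pos by (simp add: power_mult_distrib power_divide q\<^sub>0 power2_eq_square[of \<zeta>])
    moreover have "(r \<bullet> h)\<^sup>2 = 4 / (\<zeta> * (\<phi> + (norm w)\<^sup>2)) * (w \<bullet> y)\<^sup>2"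
      unfolding r h inner_block_vec
      using pos by (simp add: power_mult_distrib power_divide r\<^sub>1 power2_eq_square[of \<zeta>])
    moreover have "(norm y)\<^sup>2 = (\<Sum>j\<in>UNIV. (y $ j)\<^sup>2)"
      unfolding power2_norm_eq_inner by (simp add: inner_vec_def power2_eq_square)
    ultimately show ?thesis
      unfolding D quadratic_form_diag_minus_squares
      by (simp add: h UNIV_Plus_UNIV[symmetric] sum.Plus sum_distrib_left del: UNIV_Plus_UNIV)
  qed
  finally show "0 < h \<bullet> ((D - outer_square q - outer_square r) *v h)" .
qed

section \<open>The Hessian of the barrier\<close>

theorem theorem2:
  fixes \<alpha> u \<tau> :: "real ^ 'm::finite" and w :: "real ^ 'n::finite"
    and \<phi> \<zeta> p\<^sub>0 p\<^sub>1 q\<^sub>0 r\<^sub>1 :: real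
    and D :: "real ^ ('m + 'n) ^ ('m + 'n)" and p q r :: "real ^ ('m + 'n)"
  assumes \<alpha>_pos: "\<forall>i. 0 < \<alpha> $ i" and \<alpha>_sum: "(\<Sum>i\<in>UNIV. \<alpha> $ i) = 1"
    and z: "block_vec u w \<in> interior (gpow_dual_cone \<alpha>)"
    and \<phi>: "\<phi> = (\<Prod>i\<in>UNIV. (u $ i / \<alpha> $ i) powr (2 * \<alpha> $ i))"
    and \<zeta>: "\<zeta> = (\<Prod>i\<in>UNIV. (u $ i / \<alpha> $ i) powr (2 * \<alpha> $ i)) - (norm w)\<^sup>2"
    and \<tau>: "\<tau> = (\<chi> i. 2 * \<alpha> $ i / u $ i)"
    and D: "D = diag_matrix (block_vec
              (\<chi> i. \<tau> $ i * \<phi> / (\<zeta> * u $ i) + (1 - \<alpha> $ i) / (u $ i)\<^sup>2)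
              (\<chi> j. 2 / \<zeta>))"
    and p\<^sub>0: "p\<^sub>0 = sqrt (\<phi> * (\<phi> + (norm w)\<^sup>2) / 2)"
    and p\<^sub>1: "p\<^sub>1 = - 2 * sqrt (2 * \<phi> / (\<phi> + (norm w)\<^sup>2))"
    and q\<^sub>0: "q\<^sub>0 = sqrt (\<zeta> * \<phi> / 2)"
    and r\<^sub>1: "r\<^sub>1 = 2 * sqrt (\<zeta> / (\<phi> + (norm w)\<^sup>2))"
    and p: "p = block_vec ((p\<^sub>0 / \<zeta>) *\<^sub>R \<tau>) ((p\<^sub>1 / \<zeta>) *\<^sub>R w)"
    and q: "q = block_vec ((q\<^sub>0 / \<zeta>) *\<^sub>R \<tau>) 0"
    and r: "r = block_vec 0 ((r\<^sub>1 / \<zeta>) *\<^sub>R w)"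
  shows "\<exists>H. has_hessian (gpow_dual_barrier \<alpha>) H (block_vec u w) \<and>
           H = D + outer_square p - outer_square q - outer_square r \<and>
           (2 \<le> CARD('m) \<longrightarrow>
              augmented_sparse H D [p] [q, r] \<and>
              positive_definite (D - outer_square q - outer_square r))"
proof -
  have \<alpha>: "\<And>i. 0 < \<alpha> $ i"
    using \<alpha>_pos by blast
  define H where "H = D + outer_square p - outer_square q - outer_square r"
  have \<phi>': "\<phi> = power_prod \<alpha> u"
    by (simp add: \<phi> power_prod_def)
  have \<zeta>': "\<zeta> = power_gap \<alpha> (block_vec u w)"
    by (simp add: \<zeta> power_gap_def power_prod_def)
  have \<tau>': "\<tau> = log_gradient \<alpha> u"
    by (simp add: \<tau> log_gradient_def)
  have \<zeta>_diff: "\<zeta> = \<phi> - (norm w)\<^sup>2"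
    by (simp add: \<zeta> \<phi>)
  have u: "0 < u $ i" for i
    using interior_gpow_dual_cone(1)[OF \<alpha> z] by simp
  have \<zeta>_pos: "0 < \<zeta>"
    using interior_gpow_dual_cone(2)[OF \<alpha> z] by (simp add: \<zeta>')
  then have \<phi>_pos: "0 < \<phi>"
    unfolding \<zeta>_diff by (smt (verit) zero_le_power2)
  define s where "s = \<phi> + (norm w)\<^sup>2"
  have s: "0 < s"
    using \<phi>_pos by (simp add: s_def add_pos_nonneg)
  have squares: "p\<^sub>0\<^sup>2 = \<phi> * s / 2" "q\<^sub>0\<^sup>2 = \<zeta> * \<phi> / 2" "p\<^sub>1\<^sup>2 = 8 * \<phi> / s" "r\<^sub>1\<^sup>2 = 4 * \<zeta> / s"
    using \<phi>_pos \<zeta>_pos s by (simp_all add: p\<^sub>0 q\<^sub>0 p\<^sub>1 r\<^sub>1 s_def[symmetric] power_mult_distrib)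
  have uu: "p\<^sub>0\<^sup>2 - q\<^sub>0\<^sup>2 = \<phi> * (\<phi> - \<zeta>)"
    unfolding squares by (simp add: s_def \<zeta>_diff field_simps)
  have "p\<^sub>0 * p\<^sub>1 = - 2 * sqrt (\<phi> * s / 2 * (2 * \<phi> / s))"
    by (simp add: p\<^sub>0 p\<^sub>1 s_def real_sqrt_mult[symmetric] del: times_divide_eq_left times_divide_eq_right)
  also have "\<phi> * s / 2 * (2 * \<phi> / s) = \<phi>\<^sup>2"
    using s by (simp add: power2_eq_square)
  finally have uw: "p\<^sub>0 * p\<^sub>1 = - 2 * \<phi>"
    using \<phi>_pos by simp
  have "8 * \<phi> - 4 * \<zeta> = 4 * s"
    by (simp add: s_def \<zeta>_diff)
  then have ww: "p\<^sub>1\<^sup>2 - r\<^sub>1\<^sup>2 = 4"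
    unfolding squares diff_divide_distrib[symmetric] using s by simp
  have "\<forall>\<^sub>F y in nhds (block_vec u w).
      (gpow_dual_barrier \<alpha> has_derivative (\<lambda>h. barrier_gradient \<alpha> y \<bullet> h)) (at y)"
    using eventually_nhds_in_open[OF open_interior z]
    by eventually_elim (intro has_derivative_barrier interior_gpow_dual_cone[OF \<alpha>] \<alpha>)
  then have hessian: "has_hessian (gpow_dual_barrier \<alpha>) H (block_vec u w)"
    unfolding has_hessian_def H_def
    using has_derivative_barrier_gradient[OF \<alpha> u \<zeta>_pos \<zeta>' \<phi>' \<tau>' D p q r uu uw ww] by blast
  have definite: "positive_definite (D - outer_square q - outer_square r)" if "2 \<le> CARD('m)"
    using positive_definite_barrier_part[OF \<alpha> \<alpha>_sum that u \<phi>_pos \<zeta>_pos \<zeta>_diff \<tau>' D q r]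
      squares(2,4) by (simp add: s_def)
  have "augmented_sparse H D [p] [q, r]" if "2 \<le> CARD('m)"
    using definite[OF that] D by (simp add: augmented_sparse_def H_def diff_diff_eq)
  with hessian definite show ?thesis
    unfolding H_def by blast
qed

end
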